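(* Let $U\subset\Sigma\setminus\{0\}$ be open and let $E:U\to T\Sigma$, $E(x,y)=E^1(x,y)\,e_1+E^2(x,y)\,e_2$, be a smooth vector field on $U$ with component functions $E^1,E^2:U\to\mathbb{R}$ such that for each $(x,y)\in U$ the vector $(E^1(x,y),E^2(x,y))^\top\in\mathbb{R}^2$ is a unit-length (in the Euclidean norm) eigenvector of the matrix $\begin{pmatrix} x & y \\ y & -x\end{pmatrix}$. Then $\nabla E\equiv0$ on $U$, where $\nabla$ is the Levi-Civita connection of the metric $g$ defined in the context.
   Context: $\Sigma=\left\{\begin{pmatrix} x & y \\ y & -x\end{pmatrix}: x,y\in\mathbb{R}\right\}$ is the space of real symmetric trace-free $2\times2$ matrices, a smooth manifold identified with $\mathbb{R}^2$ via global coordinates $(x,y)$. Polar coordinates are $(x,y)=(r\cos\phi,r\sin\phi)$, with coordinate vector fields $\partial_r=\cos\phi\,\partial_x+\sin\phi\,\partial_y$ and $\partial_\phi=-r\sin\phi\,\partial_x+r\cos\phi\,\partial_y$. The metric $g$ on $\Sigma\setminus\{0\}$ is, in coordinates $(x,y)$, $g=\begin{pmatrix}1+3x^2/r^2&3xy/r^2\\3xy/r^2&1+3y^2/r^2\end{pmatrix}$, equivalently $g(\partial_r,\partial_r)=4$, $g(\partial_r,\partial_\phi)=0$, $g(\partial_\phi,\partial_\phi)=r^2$. The $g$-orthonormal reference frame on $\Sigma\setminus\{0\}$ is $e_1=\cos\phi\,\frac{\partial_r}{2}-\sin\phi\,\frac{\partial_\phi}{r}$, $e_2=\sin\phi\,\frac{\partial_r}{2}+\cos\phi\,\frac{\partial_\phi}{r}$.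 *)

theory Defs
  imports "HOL-Analysis.Analysis"
begin

section \<open>Smooth maps\<close>

fun Ck_on :: "nat \<Rightarrow> 'a::real_normed_vector set \<Rightarrow> ('a \<Rightarrow> 'b::real_normed_vector) \<Rightarrow> bool"
  where
    "Ck_on 0 U f \<longleftrightarrow> continuous_on U f"
  | "Ck_on (Suc k) U f \<longleftrightarrow>
       (\<forall>x\<in>U. f differentiable (at x)) \<and>
       (\<forall>v. Ck_on k U (\<lambda>x. frechet_derivative f (at x) v))"

text \<open>Only meant for open sets, since the derivatives are taken at \<open>at x\<close>.\<close>

definition smooth_on :: "'a::real_normed_vector set \<Rightarrow> ('a \<Rightarrow> 'b::real_normed_vector) \<Rightarrow> bool"
  where "smooth_on U f \<longleftrightarrow> (\<forall>k. Ck_on k U f)"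


section \<open>The Levi-Civita connection in a global chart\<close>

text \<open>
  A metric on an open subset of \<open>real^'n\<close> is given by its Gram matrix \<open>G\<close> in the standard
  coordinates, and a vector field by its components with respect to the coordinate fields.
\<close>

definition metric_at :: "(real^'n \<Rightarrow> real^'n^'n) \<Rightarrow> real^'n \<Rightarrow> real^'n \<Rightarrow> real^'n \<Rightarrow> real"
  where "metric_at G p u v = u \<bullet> (G p *v v)"

definition metric_partial :: "(real^'n \<Rightarrow> real^'n^'n) \<Rightarrow> real^'n \<Rightarrow> 'n \<Rightarrow> 'n \<Rightarrow> 'n \<Rightarrow> real"
  where "metric_partial G p i j l = frechet_derivative (\<lambda>q. G q $ j $ l) (at p) (axis i 1)"

text \<open>\<open>christoffel G p k i j\<close> is the Christoffel symbol of the second kind with upper index \<open>k\<close>.\<close>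

definition christoffel :: "(real^'n \<Rightarrow> real^'n^'n) \<Rightarrow> real^'n \<Rightarrow> 'n \<Rightarrow> 'n \<Rightarrow> 'n \<Rightarrow> real"
  where "christoffel G p k i j =
    (1/2) * (\<Sum>l\<in>UNIV. matrix_inv (G p) $ k $ l *
       (metric_partial G p i j l + metric_partial G p j i l - metric_partial G p l i j))"

definition christoffel_form ::
    "(real^'n \<Rightarrow> real^'n^'n) \<Rightarrow> real^'n \<Rightarrow> real^'n \<Rightarrow> real^'n \<Rightarrow> real^'n"
  where "christoffel_form G p v w =
    (\<chi> k. \<Sum>i\<in>UNIV. \<Sum>j\<in>UNIV. christoffel G p k i j * v $ i * w $ j)"

text \<open>
  \<open>levi_civita G Y p v\<close> is the covariant derivative at \<open>p\<close> of the vector field \<open>Y\<close> in the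
  direction of the tangent vector \<open>v\<close>. The lemmas \<open>levi_civita_torsion_free\<close>,
  \<open>levi_civita_metric\<close> and \<open>christoffel_form_unique\<close> below show that this is the unique
  torsion-free connection compatible with the metric.
\<close>

definition levi_civita ::
    "(real^'n \<Rightarrow> real^'n^'n) \<Rightarrow> (real^'n \<Rightarrow> real^'n) \<Rightarrow> real^'n \<Rightarrow> real^'n \<Rightarrow> real^'n"
  where "levi_civita G Y p v = frechet_derivative Y (at p) v + christoffel_form G p v (Y p)"

definition lie_bracket ::
    "(real^'n \<Rightarrow> real^'n) \<Rightarrow> (real^'n \<Rightarrow> real^'n) \<Rightarrow> real^'n \<Rightarrow> real^'n"
  where "lie_bracket X Y p = frechet_derivative Y (at p) (X p) - frechet_derivative X (at p) (Y p)"

lemma metric_at_sum: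
  "metric_at G p u v = (\<Sum>i\<in>UNIV. \<Sum>j\<in>UNIV. G p $ i $ j * u $ i * v $ j)"
  by (simp add: metric_at_def inner_vec_def matrix_vector_mult_def sum_distrib_left mult_ac)

lemma metric_partial_sym:
  assumes "open U" "p \<in> U" "\<And>q. q \<in> U \<Longrightarrow> transpose (G q) = G q"
    and "\<And>j l. (\<lambda>q. G q $ j $ l) differentiable (at p)"
  shows "metric_partial G p i j l = metric_partial G p i l j"
proof -
  have "G q $ j $ l = G q $ l $ j" if "q \<in> U" for q
    using assms(3)[OF that] by (metis transpose_def vec_lambda_beta)
  then have "frechet_derivative (\<lambda>q. G q $ j $ l) (at p) = frechet_derivative (\<lambda>q. G q $ l $ j) (at p)"
    by (intro frechet_derivative_transform_within_open[OF assms(4,1,2)])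
  then show ?thesis by (simp add: metric_partial_def)
qed

lemma christoffel_sym:
  assumes "\<And>i j l. metric_partial G p i j l = metric_partial G p i l j"
  shows "christoffel G p k i j = christoffel G p k j i"
proof -
  have "metric_partial G p i j l + metric_partial G p j i l - metric_partial G p l i j =
        metric_partial G p j i l + metric_partial G p i j l - metric_partial G p l j i" for l
    using assms[of l i j] by simp
  then show ?thesis by (simp only: christoffel_def)
qed

lemma christoffel_form_sym:
  assumes "\<And>i j l. metric_partial G p i j l = metric_partial G p i l j"
  shows "christoffel_form G p v w = christoffel_form G p w v"
proof -
  have "(\<Sum>i\<in>UNIV. \<Sum>j\<in>UNIV. christoffel G p k i j * v $ i * w $ j) =
        (\<Sum>i\<in>UNIV. \<Sum>j\<in>UNIV. christoffel G p k i j * w $ i * v $ j)" for k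
    by (subst sum.swap) (simp add: christoffel_sym[OF assms, of k] mult_ac)
  then show ?thesis by (simp add: christoffel_form_def)
qed

lemma matrix_inv_cancel:
  fixes A :: "real^'n^'n"
  assumes "invertible A"
  shows "A ** matrix_inv A = mat 1" "matrix_inv A ** A = mat 1"
  using someI_ex[OF assms[unfolded invertible_def]] by (auto simp: matrix_inv_def)

lemma christoffel_lowered:
  fixes G :: "real^'n \<Rightarrow> real^'n^'n"
  assumes "invertible (G p)"
  shows "(\<Sum>k\<in>UNIV. G p $ m $ k * christoffel G p k i j) =
    (metric_partial G p i j m + metric_partial G p j i m - metric_partial G p m i j) / 2"
proof -
  define T where "T l = metric_partial G p i j l + metric_partial G p j i l - metric_partial G p l i j" for l
  have id: "(\<Sum>k\<in>UNIV. G p $ m $ k * matrix_inv (G p) $ k $ l) = (if m = l then 1 else 0)" for l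
  proof -
    have "(G p ** matrix_inv (G p)) $ m $ l = (mat 1 :: real^'n^'n) $ m $ l"
      using matrix_inv_cancel(1)[OF assms] by simp
    then show ?thesis by (simp add: matrix_matrix_mult_def mat_def)
  qed
  have "(\<Sum>k\<in>UNIV. G p $ m $ k * christoffel G p k i j) =
    (\<Sum>k\<in>UNIV. \<Sum>l\<in>UNIV. G p $ m $ k * matrix_inv (G p) $ k $ l * (T l / 2))"
    by (simp add: christoffel_def T_def sum_distrib_left mult_ac)
  also have "\<dots> = (\<Sum>l\<in>UNIV. (\<Sum>k\<in>UNIV. G p $ m $ k * matrix_inv (G p) $ k $ l) * (T l / 2))"
    by (subst sum.swap) (simp only: sum_distrib_right)
  also have "\<dots> = T m / 2"
    by (simp add: id if_distrib if_distribR cong: if_cong)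
  finally show ?thesis by (simp add: T_def)
qed

lemma metric_at_christoffel_form:
  assumes "invertible (G p)"
  shows "metric_at G p u (christoffel_form G p v w) =
    (\<Sum>l\<in>UNIV. \<Sum>i\<in>UNIV. \<Sum>j\<in>UNIV.
       (metric_partial G p i j l + metric_partial G p j i l - metric_partial G p l i j) / 2
         * u $ l * v $ i * w $ j)"
proof -
  have "(\<Sum>k\<in>UNIV. G p $ l $ k * u $ l * christoffel_form G p v w $ k) =
    (\<Sum>i\<in>UNIV. \<Sum>j\<in>UNIV.
       (metric_partial G p i j l + metric_partial G p j i l - metric_partial G p l i j) / 2
         * u $ l * v $ i * w $ j)" for l
  proof -
    have "(\<Sum>k\<in>UNIV. G p $ l $ k * u $ l * christoffel_form G p v w $ k) =
      (\<Sum>k\<in>UNIV. \<Sum>i\<in>UNIV. \<Sum>j\<in>UNIV. (G p $ l $ k * christoffel G p k i j) * (u $ l * v $ i * w $ j))"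
      by (simp add: christoffel_form_def sum_distrib_left mult_ac)
    also have "\<dots> = (\<Sum>i\<in>UNIV. \<Sum>k\<in>UNIV. \<Sum>j\<in>UNIV. (G p $ l $ k * christoffel G p k i j) * (u $ l * v $ i * w $ j))"
      by (rule sum.swap)
    also have "\<dots> = (\<Sum>i\<in>UNIV. \<Sum>j\<in>UNIV. \<Sum>k\<in>UNIV. (G p $ l $ k * christoffel G p k i j) * (u $ l * v $ i * w $ j))"
      by (intro sum.cong refl sum.swap)
    also have "\<dots> = (\<Sum>i\<in>UNIV. \<Sum>j\<in>UNIV.
       (metric_partial G p i j l + metric_partial G p j i l - metric_partial G p l i j) / 2
         * (u $ l * v $ i * w $ j))"
      by (simp only: sum_distrib_right[symmetric] christoffel_lowered[where G=G and p=p, OF assms])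
    finally show ?thesis by (simp only: mult.assoc)
  qed
  then show ?thesis by (simp add: metric_at_sum)
qed

lemma metric_at_sym:
  assumes "transpose (G p) = G p"
  shows "metric_at G p u v = metric_at G p v u"
  by (simp add: metric_at_def inner_commute[of v]) (metis assms dot_lmul_matrix vector_transpose_matrix)

lemma christoffel_form_metric:
  assumes "invertible (G p)" "transpose (G p) = G p"
    and sym: "\<And>i j l. metric_partial G p i j l = metric_partial G p i l j"
  shows "metric_at G p (christoffel_form G p v y) z + metric_at G p y (christoffel_form G p v z) =
    (\<Sum>i\<in>UNIV. \<Sum>j\<in>UNIV. \<Sum>l\<in>UNIV. metric_partial G p i j l * v $ i * y $ j * z $ l)"
proof -
  let ?d = "metric_partial G p"
  have "metric_at G p (christoffel_form G p v y) z =
      (\<Sum>l\<in>UNIV. \<Sum>i\<in>UNIV. \<Sum>j\<in>UNIV. (?d i j l + ?d j i l - ?d l i j) / 2 * z $ l * v $ i * y $ j)"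
    by (simp only: metric_at_sym[where G=G and p=p, OF assms(2)] metric_at_christoffel_form[where G=G and p=p, OF assms(1)])
  also have "\<dots> = (\<Sum>i\<in>UNIV. \<Sum>l\<in>UNIV. \<Sum>j\<in>UNIV. (?d i j l + ?d j i l - ?d l i j) / 2 * z $ l * v $ i * y $ j)"
    by (rule sum.swap)
  also have "\<dots> = (\<Sum>i\<in>UNIV. \<Sum>j\<in>UNIV. \<Sum>l\<in>UNIV. (?d i j l + ?d j i l - ?d l i j) / 2 * z $ l * v $ i * y $ j)"
    by (intro sum.cong refl sum.swap)
  finally have 1: "metric_at G p (christoffel_form G p v y) z = \<dots>" .
  have 2: "metric_at G p y (christoffel_form G p v z) =
      (\<Sum>i\<in>UNIV. \<Sum>j\<in>UNIV. \<Sum>l\<in>UNIV. (?d i l j + ?d l i j - ?d j i l) / 2 * y $ j * v $ i * z $ l)"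
    unfolding metric_at_christoffel_form[where G=G and p=p, OF assms(1)] by (rule sum.swap)
  have "(?d i j l + ?d j i l - ?d l i j) / 2 * z $ l * v $ i * y $ j
      + (?d i l j + ?d l i j - ?d j i l) / 2 * y $ j * v $ i * z $ l
      = ?d i j l * v $ i * y $ j * z $ l" for i j l
    unfolding sym[of i l j] by (simp add: field_simps)
  then show ?thesis unfolding 1 2 by (simp only: sum.distrib[symmetric])
qed

lemma levi_civita_torsion_free:
  assumes "open U" "p \<in> U" "\<And>q. q \<in> U \<Longrightarrow> transpose (G q) = G q"
    and "\<And>j l. (\<lambda>q. G q $ j $ l) differentiable (at p)"
  shows "levi_civita G Y p (X p) - levi_civita G X p (Y p) = lie_bracket X Y p"
  using christoffel_form_sym[where G=G and p=p, OF metric_partial_sym[OF assms], of "X p" "Y p"]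
  by (simp add: levi_civita_def lie_bracket_def)

lemma frechet_derivative_cart_expand:
  fixes f :: "real^'n \<Rightarrow> real"
  assumes "f differentiable (at p)"
  shows "frechet_derivative f (at p) v = (\<Sum>i\<in>UNIV. frechet_derivative f (at p) (axis i 1) * v $ i)"
proof -
  have lin: "linear (frechet_derivative f (at p))"
    by (rule linear_frechet_derivative[OF assms])
  have "frechet_derivative f (at p) v = frechet_derivative f (at p) (\<Sum>i\<in>UNIV. v $ i *s axis i 1)"
    by (simp add: basis_expansion)
  also have "\<dots> = (\<Sum>i\<in>UNIV. frechet_derivative f (at p) (axis i 1) * v $ i)"
    by (simp add: linear_sum[OF lin] scalar_mult_eq_scaleR linear_scale[OF lin] mult.commute)
  finally show ?thesis .
qed

lemma levi_civita_metric:
  assumes "open U" "p \<in> U" "\<And>q. q \<in> U \<Longrightarrow> transpose (G q) = G q" "invertible (G p)"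
    and dG: "\<And>j l. (\<lambda>q. G q $ j $ l) differentiable (at p)"
    and dY: "Y differentiable (at p)" and dZ: "Z differentiable (at p)"
  shows "((\<lambda>q. metric_at G q (Y q) (Z q)) has_derivative
    (\<lambda>v. metric_at G p (levi_civita G Y p v) (Z p) + metric_at G p (Y p) (levi_civita G Z p v))) (at p)"
proof -
  let ?DY = "frechet_derivative Y (at p)" and ?DZ = "frechet_derivative Z (at p)"
  have Y: "((\<lambda>q. Y q $ i) has_derivative (\<lambda>v. ?DY v $ i)) (at p)" for i
    using dY by (intro bounded_linear.has_derivative[OF bounded_linear_vec_nth]) (simp add: frechet_derivative_works[symmetric])
  have Z: "((\<lambda>q. Z q $ i) has_derivative (\<lambda>v. ?DZ v $ i)) (at p)" for i
    using dZ by (intro bounded_linear.has_derivative[OF bounded_linear_vec_nth]) (simp add: frechet_derivative_works[symmetric])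
  have G: "((\<lambda>q. G q $ j $ l) has_derivative (\<lambda>v. \<Sum>i\<in>UNIV. metric_partial G p i j l * v $ i)) (at p)" for j l
  proof -
    have "frechet_derivative (\<lambda>q. G q $ j $ l) (at p) = (\<lambda>v. \<Sum>i\<in>UNIV. metric_partial G p i j l * v $ i)"
      using frechet_derivative_cart_expand[OF dG[of j l]] unfolding metric_partial_def by (rule ext)
    with dG[of j l] show ?thesis by (simp only: frechet_derivative_works)
  qed
  have "((\<lambda>q. \<Sum>j\<in>UNIV. \<Sum>l\<in>UNIV. G q $ j $ l * Y q $ j * Z q $ l) has_derivative
    (\<lambda>v. \<Sum>j\<in>UNIV. \<Sum>l\<in>UNIV. (G p $ j $ l * Y p $ j) * ?DZ v $ l +
       (G p $ j $ l * ?DY v $ j + (\<Sum>i\<in>UNIV. metric_partial G p i j l * v $ i) * Y p $ j) * Z p $ l)) (at p)"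
    by (intro has_derivative_sum has_derivative_mult Y Z G)
  moreover have "(\<Sum>j\<in>UNIV. \<Sum>l\<in>UNIV. (G p $ j $ l * Y p $ j) * ?DZ v $ l +
       (G p $ j $ l * ?DY v $ j + (\<Sum>i\<in>UNIV. metric_partial G p i j l * v $ i) * Y p $ j) * Z p $ l) =
     metric_at G p (levi_civita G Y p v) (Z p) + metric_at G p (Y p) (levi_civita G Z p v)" for v
  proof -
    have "(\<Sum>j\<in>UNIV. \<Sum>l\<in>UNIV. (G p $ j $ l * Y p $ j) * ?DZ v $ l +
       (G p $ j $ l * ?DY v $ j + (\<Sum>i\<in>UNIV. metric_partial G p i j l * v $ i) * Y p $ j) * Z p $ l) =
      metric_at G p (?DY v) (Z p) + metric_at G p (Y p) (?DZ v) +
      (\<Sum>j\<in>UNIV. \<Sum>l\<in>UNIV. \<Sum>i\<in>UNIV. metric_partial G p i j l * v $ i * Y p $ j * Z p $ l)"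
      by (simp add: metric_at_sum sum.distrib ring_distribs sum_distrib_right sum_distrib_left mult_ac)
    also have "(\<Sum>j\<in>UNIV. \<Sum>l\<in>UNIV. \<Sum>i\<in>UNIV. metric_partial G p i j l * v $ i * Y p $ j * Z p $ l) =
      (\<Sum>j\<in>UNIV. \<Sum>i\<in>UNIV. \<Sum>l\<in>UNIV. metric_partial G p i j l * v $ i * Y p $ j * Z p $ l)"
      by (intro sum.cong refl sum.swap)
    also have "\<dots> = (\<Sum>i\<in>UNIV. \<Sum>j\<in>UNIV. \<Sum>l\<in>UNIV. metric_partial G p i j l * v $ i * Y p $ j * Z p $ l)"
      by (rule sum.swap)
    also have "\<dots> = metric_at G p (christoffel_form G p v (Y p)) (Z p)
        + metric_at G p (Y p) (christoffel_form G p v (Z p))"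
      by (rule christoffel_form_metric[symmetric, OF assms(4) assms(3)[OF assms(2)]
            metric_partial_sym[OF assms(1,2,3) dG]])
    finally show ?thesis
      by (simp add: levi_civita_def metric_at_def inner_add_left inner_add_right
          matrix_vector_right_distrib)
  qed
  ultimately show ?thesis by (simp add: metric_at_sum)
qed

lemma christoffel_form_unique:
  fixes \<Gamma> :: "real^'n \<Rightarrow> real^'n \<Rightarrow> real^'n"
  assumes inv: "invertible (G p)" and Gsym: "transpose (G p) = G p"
    and dsym: "\<And>i j l. metric_partial G p i j l = metric_partial G p i l j"
    and \<Gamma>_sym: "\<And>v w. \<Gamma> v w = \<Gamma> w v"
    and \<Gamma>_metric: "\<And>v y z. metric_at G p (\<Gamma> v y) z + metric_at G p y (\<Gamma> v z) =
      (\<Sum>i\<in>UNIV. \<Sum>j\<in>UNIV. \<Sum>l\<in>UNIV. metric_partial G p i j l * v $ i * y $ j * z $ l)"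
  shows "\<Gamma> v w = christoffel_form G p v w"
proof -
  define D where "D v w = \<Gamma> v w - christoffel_form G p v w" for v w
  define T where "T u v w = metric_at G p u (D v w)" for u v w
  have Dsym: "D v w = D w v" for v w
    using christoffel_form_sym[OF dsym, of v w] \<Gamma>_sym[of v w] by (simp add: D_def)
  have skew: "T z v y = - T y v z" for v y z
    using \<Gamma>_metric[of v y z] christoffel_form_metric[where G=G and p=p, OF inv Gsym dsym, of v y z]
      metric_at_sym[where G=G and p=p, OF Gsym, of z]
    by (simp add: T_def D_def metric_at_def inner_diff_right matrix_vector_mult_diff_distrib)
  have sym: "T u v w = T u w v" for u v w
    by (simp add: T_def Dsym[of v w])
  have "T u v w = 0" for u
    using skew[of u v w] skew[of w u v] skew[of v w u] sym[of u v w] sym[of w v u] sym[of v u w]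
    by linarith
  then have "u \<bullet> (G p *v D v w) = 0" for u
    by (simp add: T_def metric_at_def)
  then have "G p *v D v w = 0"
    using inner_eq_zero_iff by blast
  then have "matrix_inv (G p) *v (G p *v D v w) = 0"
    by simp
  then have "D v w = 0"
    by (simp add: matrix_vector_mul_assoc matrix_inv_cancel[OF inv])
  then show ?thesis by (simp add: D_def)
qed


section \<open>Trace-free symmetric matrices\<close>

text \<open>A point of the space of matrices is represented by its coordinates \<open>(x, y)\<close>.\<close>

definition sigma_matrix :: "real^2 \<Rightarrow> real^2^2"
  where "sigma_matrix p = vector [vector [p$1, p$2], vector [p$2, - p$1]]"

lemma bij_betw_sigma_matrix:
  "bij_betw sigma_matrix UNIV {A. transpose A = A \<and> trace A = 0}"
proof (rule bij_betwI[where g = "\<lambda>A. vector [A$1$1, A$1$2]"])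
  show "sigma_matrix \<in> UNIV \<rightarrow> {A. transpose A = A \<and> trace A = 0}"
    by (auto simp: sigma_matrix_def transpose_def trace_def sum_2 vec_eq_iff forall_2)
  show "sigma_matrix (vector [A$1$1, A$1$2]) = A" if "A \<in> {A. transpose A = A \<and> trace A = 0}" for A
  proof -
    have "transpose A $ 1 $ 2 = A $ 1 $ 2" "A $ 1 $ 1 + A $ 2 $ 2 = 0"
      using that by (simp_all add: trace_def sum_2)
    then have "A $ 2 $ 1 = A $ 1 $ 2" "A $ 2 $ 2 = - A $ 1 $ 1"
      by (simp_all add: transpose_def)
    then show ?thesis by (simp add: sigma_matrix_def vec_eq_iff forall_2)
  qed
qed (auto simp: sigma_matrix_def vec_eq_iff forall_2)

definition is_eigenvector :: "real^'n^'n \<Rightarrow> real^'n \<Rightarrow> bool"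
  where "is_eigenvector A v \<longleftrightarrow> v \<noteq> 0 \<and> (\<exists>c. A *v v = c *s v)"

definition sigma_metric :: "real^2 \<Rightarrow> real^2^2"
  where "sigma_metric p = (let x = p$1; y = p$2; r = norm p in
    vector [vector [1 + 3 * x^2 / r^2, 3 * x * y / r^2],
            vector [3 * x * y / r^2, 1 + 3 * y^2 / r^2]])"

lemma sigma_metric_sym: "transpose (sigma_metric p) = sigma_metric p"
  by (simp add: sigma_metric_def Let_def transpose_def vec_eq_iff forall_2)

lemma sigma_metric_invertible:
  assumes "p \<noteq> 0"
  shows "invertible (sigma_metric p)"
proof -
  have "det (sigma_metric p) = 1 + 3 * (p$1 ^ 2 + p$2 ^ 2) / norm p ^ 2"
    by (simp add: det_2 sigma_metric_def Let_def algebra_simps add_divide_distrib power2_eq_square)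
  also have "p$1 ^ 2 + p$2 ^ 2 = norm p ^ 2"
    by (simp only: power2_norm_eq_inner inner_vec_def sum_2) (simp add: power2_eq_square)
  also have "1 + 3 * norm p ^ 2 / norm p ^ 2 = 4"
    using assms by simp
  finally have "det (sigma_metric p) = 4" .
  then show ?thesis by (simp add: invertible_det_nz)
qed

lemma sigma_metric_differentiable:
  assumes "p \<noteq> 0"
  shows "(\<lambda>q. sigma_metric q $ j $ l) differentiable (at p)"
proof -
  have norm: "(\<lambda>q::real^2. norm q ^ 2) differentiable (at p)" "norm p ^ 2 \<noteq> 0"
    using assms by (auto simp: power2_norm_eq_inner)
  have nth: "(\<lambda>q::real^2. q $ i) differentiable (at p)" for i
    using bounded_linear_vec_nth by (rule bounded_linear_imp_differentiable)
  have "(\<lambda>q. 1 + 3 * (q$1)^2 / norm q ^ 2) differentiable (at p)"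
    "(\<lambda>q. 3 * q$1 * q$2 / norm q ^ 2) differentiable (at p)"
    "(\<lambda>q. 1 + 3 * (q$2)^2 / norm q ^ 2) differentiable (at p)"
    using norm by (auto intro!: derivative_intros nth)
  then show ?thesis
    using exhaust_2[of j] exhaust_2[of l] by (auto simp: sigma_metric_def Let_def)
qed

text \<open>
  The choice of a branch of the polar angle is immaterial: only its sine and cosine are used.
\<close>

definition polar_angle :: "real^2 \<Rightarrow> real"
  where "polar_angle p = Arg (Complex (p$1) (p$2))"

definition d_r :: "real^2 \<Rightarrow> real^2"
  where "d_r p = vector [cos (polar_angle p), sin (polar_angle p)]"

definition d_phi :: "real^2 \<Rightarrow> real^2"
  where "d_phi p = vector [- norm p * sin (polar_angle p), norm p * cos (polar_angle p)]"

definition frame1 :: "real^2 \<Rightarrow> real^2"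
  where "frame1 p = (cos (polar_angle p) / 2) *\<^sub>R d_r p - (sin (polar_angle p) / norm p) *\<^sub>R d_phi p"

definition frame2 :: "real^2 \<Rightarrow> real^2"
  where "frame2 p = (sin (polar_angle p) / 2) *\<^sub>R d_r p + (cos (polar_angle p) / norm p) *\<^sub>R d_phi p"

lemma polar_coordinates:
  "p$1 = norm p * cos (polar_angle p)" "p$2 = norm p * sin (polar_angle p)"
proof -
  have "norm p = cmod (Complex (p$1) (p$2))"
    by (simp add: norm_vec_def L2_set_def sum_2 cmod_def)
  then have "rcis (norm p) (polar_angle p) = Complex (p$1) (p$2)"
    by (simp add: polar_angle_def rcis_cmod_Arg)
  then show "p$1 = norm p * cos (polar_angle p)" "p$2 = norm p * sin (polar_angle p)"
    by (metis Re_rcis complex.sel(1), metis Im_rcis complex.sel(2))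
qed

lemma sigma_metric_polar:
  assumes "p \<noteq> 0"
  shows "metric_at sigma_metric p (d_r p) (d_r p) = 4"
    and "metric_at sigma_metric p (d_r p) (d_phi p) = 0"
    and "metric_at sigma_metric p (d_phi p) (d_phi p) = (norm p)^2"
proof -
  define r c s where "r = norm p" and "c = cos (polar_angle p)" and "s = sin (polar_angle p)"
  have r: "r \<noteq> 0" and cs: "c^2 + s^2 = 1"
    using assms by (simp_all add: r_def c_def s_def)
  have xy: "p$1 = r * c" "p$2 = r * s"
    using polar_coordinates[of p] by (simp_all add: r_def c_def s_def)
  have G: "sigma_metric p = vector [vector [1 + 3 * c^2, 3 * c * s], vector [3 * c * s, 1 + 3 * s^2]]"
    using r by (simp add: sigma_metric_def Let_def r_def[symmetric] xy power2_eq_square mult_ac)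
  have R: "d_r p = vector [c, s]" and P: "d_phi p = vector [- r * s, r * c]"
    by (simp_all add: d_r_def d_phi_def r_def c_def s_def)
  show "metric_at sigma_metric p (d_r p) (d_r p) = 4"
    unfolding metric_at_sum G R sum_2 vector_2 using cs by algebra
  show "metric_at sigma_metric p (d_r p) (d_phi p) = 0"
    unfolding metric_at_sum G R P sum_2 vector_2 by (simp add: algebra_simps power2_eq_square)
  show "metric_at sigma_metric p (d_phi p) (d_phi p) = (norm p)^2"
    unfolding metric_at_sum G R P sum_2 vector_2 r_def[symmetric] using cs by algebra
qed

end

theory Submission
  imports Defs
begin

text \<open>
  In the coordinates \<open>(x, y)\<close> the Christoffel form of the cone metric is
  \<open>\<Gamma>(v, w) = (3/4) (v \<bullet> Jp) (w \<bullet> Jp) p / r^4\<close>, where \<open>J\<close> is the rotation by a right angle.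
  Put \<open>P = 2 (p \<bullet> E)\<close> and \<open>B = Jp \<bullet> E\<close>. If \<open>c\<close> is the eigenvalue, then
  \<open>P^2 + B^2 = r^2\<close>, \<open>P^2 - B^2 = c x\<close> and \<open>2 P B = - c y\<close>. Eliminating \<open>c\<close> leaves the relations
  \<open>P^2 + B^2 = r^2\<close> and \<open>(P^2 - B^2) y + 2 P B x = 0\<close>, whose derivatives form a nonsingular
  linear system for \<open>dP\<close> and \<open>dB\<close>; its solution is exactly \<open>dE = - \<Gamma>(\<cdot>, E)\<close>.
  No continuous choice of the eigenvalue is needed.
\<close>

lemma norm_power2_vec2: "norm (p :: real^2) ^ 2 = (p$1)^2 + (p$2)^2"
  by (simp only: power2_norm_eq_inner inner_vec_def sum_2) (simp add: power2_eq_square)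

lemma sum_squares_vec2_nonzero: "(p :: real^2) \<noteq> 0 \<Longrightarrow> (p$1)^2 + (p$2)^2 \<noteq> 0"
  by (metis norm_power2_vec2 norm_eq_zero power_eq_0_iff)

text \<open>The Gram matrix is the identity plus three times the orthogonal projection onto the line
  through \<open>p\<close>; this single formula serves all entries when differentiating.\<close>

lemma sigma_metric_nth:
  "sigma_metric p $ j $ l = (if j = l then 1 else 0) + 3 * p$j * p$l / ((p$1)^2 + (p$2)^2)"
  using exhaust_2[of j] exhaust_2[of l]
  by (auto simp: sigma_metric_def Let_def norm_power2_vec2) (simp_all add: power2_eq_square mult_ac)

lemma has_derivative_vec_nth: "((\<lambda>q :: real^'n. q $ i) has_derivative (\<lambda>h. h $ i)) (at p)"
  by (rule bounded_linear.has_derivative[OF bounded_linear_vec_nth has_derivative_ident])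

lemma metric_partial_sigma:
  assumes "p \<noteq> 0"
  shows "metric_partial sigma_metric p i j l =
    (let N = (p$1)^2 + (p$2)^2 in
     3 * ((if i = j then 1 else 0) * p$l + (if i = l then 1 else 0) * p$j) / N
       - 6 * p$i * p$j * p$l / N^2)"
proof -
  let ?N = "\<lambda>q :: real^2. (q$1)^2 + (q$2)^2"
  note N = sum_squares_vec2_nonzero[OF assms]
  have num: "((\<lambda>q. 3 * q$j * q$l) has_derivative (\<lambda>h. 3 * (h$j * p$l + p$j * h$l))) (at p)"
    by (auto intro!: derivative_eq_intros has_derivative_vec_nth simp: algebra_simps)
  have den: "(?N has_derivative (\<lambda>h. 2 * p$1 * h$1 + 2 * p$2 * h$2)) (at p)"
    by (auto intro!: derivative_eq_intros has_derivative_vec_nth simp: algebra_simps)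
  have quot: "(a * n - b * d) / (n * n) = a / n - b * d / n^2" if "n \<noteq> 0" for a b d n :: real
    using that by (simp add: diff_divide_distrib power2_eq_square)
  have "((\<lambda>q. (if j = l then 1 else 0) + 3 * q$j * q$l / ?N q) has_derivative
     (\<lambda>h. 3 * (h$j * p$l + p$j * h$l) / ?N p
        - 3 * p$j * p$l * (2 * p$1 * h$1 + 2 * p$2 * h$2) / (?N p)^2)) (at p)"
    using has_derivative_add[OF has_derivative_const has_derivative_divide'[OF num den N]]
    unfolding quot[OF N] by simp
  then have "((\<lambda>q. sigma_metric q $ j $ l) has_derivative
     (\<lambda>h. 3 * (h$j * p$l + p$j * h$l) / ?N p
        - 3 * p$j * p$l * (2 * p$1 * h$1 + 2 * p$2 * h$2) / (?N p)^2)) (at p)"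
    by (simp only: sigma_metric_nth)
  then show ?thesis
    using exhaust_2[of i]
    by (auto simp: metric_partial_def frechet_derivative_at[symmetric] Let_def axis_def
        algebra_simps)
qed

text \<open>In Cartesian coordinates the Christoffel form is the difference from the flat
  connection. For 4 dr^2 + r^2 d\<phi>^2 the only polar symbol that differs from the Euclidean one
  is that of \<partial>_r for the pair (\<phi>, \<phi>): -r/4 instead of -r. Hence the factor 3/4,
  with \<open>p$1 * v$2 - p$2 * v$1\<close> being r^2 d\<phi>(v). By uniqueness, symmetry and metric
  compatibility of this candidate suffice, and no Gram matrix has to be inverted.\<close>

lemma christoffel_form_sigma:
  assumes "p \<noteq> 0"
  shows "christoffel_form sigma_metric p v w =
    (3/4 * (p$1 * v$2 - p$2 * v$1) * (p$1 * w$2 - p$2 * w$1) / ((p$1)^2 + (p$2)^2)^2) *\<^sub>R p"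
proof (rule christoffel_form_unique[symmetric])
  define N where "N = (p$1)^2 + (p$2)^2"
  have N: "N \<noteq> 0" using sum_squares_vec2_nonzero[OF assms] by (simp add: N_def)
  define \<Gamma> where "\<Gamma> v w = (3/4 * (p$1 * v$2 - p$2 * v$1) * (p$1 * w$2 - p$2 * w$1) / N^2) *\<^sub>R p"
    for v w :: "real^2"
  show "invertible (sigma_metric p)" by (rule sigma_metric_invertible[OF assms])
  show "transpose (sigma_metric p) = sigma_metric p" by (rule sigma_metric_sym)
  show "metric_partial sigma_metric p i j l = metric_partial sigma_metric p i l j" for i j l
    by (simp add: metric_partial_sigma[OF assms] Let_def algebra_simps)
  \<comment> \<open>\<open>p\<close> is an eigenvector of the Gram matrix with eigenvalue 1 + 3 = 4,
    so pairing with a multiple of \<open>p\<close> is four times the Euclidean product.\<close>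
  have Gp: "metric_at sigma_metric p (k *\<^sub>R p) z = 4 * k * (p$1 * z$1 + p$2 * z$2)" for k z
  proof -
    have "metric_at sigma_metric p (k *\<^sub>R p) z =
        k * (p$1 * z$1 + p$2 * z$2) * (1 + 3 * (p$1 * p$1 + p$2 * p$2) / N)"
      unfolding metric_at_sum sum_2 sigma_metric_nth N_def[symmetric]
      by (simp add: algebra_simps add_divide_distrib)
    also have "p$1 * p$1 + p$2 * p$2 = N" by (simp add: N_def power2_eq_square)
    finally show ?thesis using N by (simp add: algebra_simps)
  qed
  have comb: "4 * (3/4 * a * b / n) * d + 4 * (3/4 * a * e / n) * f = 3 * a * (b * d + e * f) / n"
    for a b d e f n :: real
    by (cases "n = 0") (simp_all add: field_simps)
  have left: "metric_at sigma_metric p (\<Gamma> v y) z + metric_at sigma_metric p y (\<Gamma> v z) =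
      3 * (p$1 * v$2 - p$2 * v$1) * ((p$1 * y$2 - p$2 * y$1) * (p$1 * z$1 + p$2 * z$2)
        + (p$1 * z$2 - p$2 * z$1) * (p$1 * y$1 + p$2 * y$2)) / N^2" for v y z
    unfolding metric_at_sym[where G=sigma_metric and p=p, OF sigma_metric_sym, of y] \<Gamma>_def Gp
    by (rule comb)
  have right: "(\<Sum>i\<in>UNIV. \<Sum>j\<in>UNIV. \<Sum>l\<in>UNIV.
        metric_partial sigma_metric p i j l * v $ i * y $ j * z $ l) =
      3 * (N * ((v$1 * y$1 + v$2 * y$2) * (p$1 * z$1 + p$2 * z$2)
          + (v$1 * z$1 + v$2 * z$2) * (p$1 * y$1 + p$2 * y$2))
        - 2 * (p$1 * v$1 + p$2 * v$2) * (p$1 * y$1 + p$2 * y$2) * (p$1 * z$1 + p$2 * z$2)) / N^2"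
    for v y z
    using N
    by (simp add: metric_partial_sigma[OF assms] Let_def sum_2 N_def[symmetric])
      (simp add: field_simps power2_eq_square)
  \<comment> \<open>This is (Jp \<bullet> v) (Jp \<bullet> y) = N (v \<bullet> y) - (p \<bullet> v)
    (p \<bullet> y), applied once as it stands and once with z for y.\<close>
  have "(p$1 * v$2 - p$2 * v$1) * ((p$1 * y$2 - p$2 * y$1) * (p$1 * z$1 + p$2 * z$2)
        + (p$1 * z$2 - p$2 * z$1) * (p$1 * y$1 + p$2 * y$2)) =
      N * ((v$1 * y$1 + v$2 * y$2) * (p$1 * z$1 + p$2 * z$2)
          + (v$1 * z$1 + v$2 * z$2) * (p$1 * y$1 + p$2 * y$2))
        - 2 * (p$1 * v$1 + p$2 * v$2) * (p$1 * y$1 + p$2 * y$2) * (p$1 * z$1 + p$2 * z$2)"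
    for v y z :: "real^2"
    unfolding N_def by algebra
  then show "metric_at sigma_metric p
       ((3/4 * (p$1 * v$2 - p$2 * v$1) * (p$1 * y$2 - p$2 * y$1) / ((p$1)^2 + (p$2)^2)^2) *\<^sub>R p) z
     + metric_at sigma_metric p y
       ((3/4 * (p$1 * v$2 - p$2 * v$1) * (p$1 * z$2 - p$2 * z$1) / ((p$1)^2 + (p$2)^2)^2) *\<^sub>R p) =
     (\<Sum>i\<in>UNIV. \<Sum>j\<in>UNIV. \<Sum>l\<in>UNIV.
        metric_partial sigma_metric p i j l * v $ i * y $ j * z $ l)" for v y z
    unfolding N_def[symmetric] \<Gamma>_def[symmetric] left right by (simp only: mult.assoc)
qed (simp add: algebra_simps)

text \<open>\<open>P\<close> and \<open>B\<close> are r times the components of \<open>e\<close>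
  along the g-unit radial and angular vectors, that is \<open>x * a + y * b\<close> and
  \<open>x * b - y * a\<close>. Up to sign these are the two rows of the matrix applied to (a, b),
  so (P, B) = c (a, -b).\<close>

lemma sigma_eigenvector_relations:
  assumes "is_eigenvector (sigma_matrix p) (vector [a, b])"
    and "norm (vector [a, b] :: real^2) = 1"
    and "e = a *\<^sub>R frame1 p + b *\<^sub>R frame2 p" and "p \<noteq> 0"
    and "x = p$1" "y = p$2" "P = 2 * (x * e$1 + y * e$2)" "B = x * e$2 - y * e$1"
  shows "\<exists>c. c \<noteq> 0 \<and> P^2 + B^2 = x^2 + y^2 \<and> P^2 - B^2 = c * x \<and> 2 * P * B = - c * y"
proof -
  obtain c where "sigma_matrix p *v vector [a, b] = c *s vector [a, b]"
    using assms(1) by (auto simp: is_eigenvector_def)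
  then have c: "x * a + y * b = c * a" "y * a - x * b = c * b"
    by (simp_all add: sigma_matrix_def matrix_vector_mult_def vec_eq_iff forall_2 sum_2 assms(5,6))
  have ab: "a^2 + b^2 = 1"
    using assms(2) norm_power2_vec2[of "vector [a, b]"] by simp
  define r C S where "r = norm p" and "C = cos (polar_angle p)" and "S = sin (polar_angle p)"
  have r: "r \<noteq> 0" and CS: "C^2 + S^2 = 1"
    using assms(4) by (simp_all add: r_def C_def S_def)
  have xy: "x = r * C" "y = r * S"
    using polar_coordinates[of p] by (simp_all add: r_def C_def S_def assms(5,6))
  have e: "e$1 = a * (C^2 / 2 + S^2) + b * (S * C / 2 - C * S)"
    "e$2 = a * (C * S / 2 - S * C) + b * (S^2 / 2 + C^2)"
    using r by (simp_all add: assms(3) frame1_def frame2_def d_r_def d_phi_def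
        r_def[symmetric] C_def[symmetric] S_def[symmetric] power2_eq_square algebra_simps)
  have "P = (x * a + y * b) * (C^2 + S^2)" "B = (x * b - y * a) * (C^2 + S^2)"
    unfolding assms(7,8) e xy by (simp_all add: algebra_simps power2_eq_square)
  then have PB: "P = c * a" "B = - c * b" using c CS by simp_all
  \<comment> \<open>A trace-free symmetric 2x2 matrix with eigenvalue c at a unit vector v equals c
    (2 v v^T - I); these are its entries.\<close>
  have xy_c: "x = c * (a^2 - b^2)" "y = c * (2 * a * b)" using c ab by algebra+
  have "c \<noteq> 0"
    using xy_c sum_squares_vec2_nonzero[OF assms(4)] by (auto simp: assms(5,6))
  moreover have "P^2 + B^2 = x^2 + y^2" "P^2 - B^2 = c * x" "2 * P * B = - c * y"
    unfolding PB xy_c using ab by algebra+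
  ultimately show ?thesis by blast
qed

text \<open>
  The last two hypotheses are the differentiated relations; primes denote derivatives in the
  direction \<open>(h, k)\<close>.
\<close>

lemma parallel_system:
  fixes x y u w h k u' w' c P B P' B' :: real
  assumes "P = 2 * (x * u + y * w)" "B = x * w - y * u"
    and "P' = 2 * (h * u + k * w + x * u' + y * w')" "B' = h * w - k * u + x * w' - y * u'"
    and "c \<noteq> 0" "P^2 + B^2 = x^2 + y^2" "P^2 - B^2 = c * x" "2 * P * B = - c * y"
    and "x^2 + y^2 \<noteq> 0"
    and "P * P' + B * B' = x * h + y * k"
    and "2 * (P * P' - B * B') * y + (P^2 - B^2) * k + 2 * (P' * B + P * B') * x + 2 * P * B * h = 0"
  shows "u' = - (3/4 * (x * k - y * h) * B / (x^2 + y^2)^2 * x)"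
    and "w' = - (3/4 * (x * k - y * h) * B / (x^2 + y^2)^2 * y)"
proof -
  \<comment> \<open>(P', B') is expanded in the orthogonal basis (P, B), (-B, P), and (h, k) in the
    basis p, Jp; all four basis vectors have squared length \<open>N\<close>. The first
    differentiated relation makes \<sigma> the first coefficient in both expansions, leaving
    \<open>Q\<close> as the only unknown.\<close>
  define N \<sigma> \<tau> Q where "N = x^2 + y^2" and "\<sigma> = x * h + y * k" and "\<tau> = x * k - y * h"
    and "Q = P * B' - P' * B"
  have N0: "N \<noteq> 0" using assms(9) by (simp add: N_def)
  have NP: "N * P' = \<sigma> * P - Q * B" and NB: "N * B' = \<sigma> * B + Q * P"
    unfolding N_def \<sigma>_def Q_def assms(6,10)[symmetric] by algebra+
  have m1: "N * (P * P' - B * B') = \<sigma> * (P^2 - B^2) - Q * (2 * P * B)"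
    using NP NB by algebra
  have m2: "N * (P' * B + P * B') = \<sigma> * (2 * P * B) + Q * (P^2 - B^2)"
    using NP NB by algebra
  \<comment> \<open>The \<sigma> terms cancel in the second differentiated relation. The outcome
    \<open>2 * Q = - \<tau>\<close> says that (P, B) turns at minus half the rate of the polar
    angle, since (P + iB)^2 = c (x - iy).\<close>
  have "N * (c * (2 * Q + \<tau>)) = 0"
  proof -
    have "0 = N * (2 * (P * P' - B * B') * y + (P^2 - B^2) * k
        + 2 * (P' * B + P * B') * x + 2 * P * B * h)"
      using assms(11) by simp
    also have "\<dots> = 2 * y * (N * (P * P' - B * B')) + N * (P^2 - B^2) * k
        + 2 * x * (N * (P' * B + P * B')) + N * (2 * P * B) * h"
      by algebra
    also have "\<dots> = N * (c * (2 * Q + \<tau>))"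
      unfolding m1 m2 assms(7,8) unfolding N_def \<tau>_def by algebra
    finally show ?thesis by simp
  qed
  then have Q: "2 * Q = - \<tau>" using N0 assms(5) by simp
  \<comment> \<open>The coefficient 3/4 arises here: \<open>- Q * B / 2\<close> contributes 1/4 of
    \<open>\<tau> * B\<close>, and moving the base point p subtracts a whole one.\<close>
  have rad: "N * (x * u' + y * w') = - (3/4) * \<tau> * B"
  proof -
    have "2 * (N * (h * u + k * w)) = \<sigma> * P + 2 * \<tau> * B"
      unfolding N_def \<sigma>_def \<tau>_def assms(1,2) by algebra
    moreover have "2 * (N * (x * u' + y * w')) = N * P' - 2 * (N * (h * u + k * w))"
      unfolding assms(3) by (simp add: algebra_simps)
    ultimately show ?thesis using NP Q by algebra
  qed
  \<comment> \<open>The turning of (P, B) exactly cancels the effect of moving p, so the derivative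
    of the field is radial, as \<Gamma> is.\<close>
  have tan: "x * w' - y * u' = 0"
  proof -
    have "2 * (N * (h * w - k * u)) = 2 * \<sigma> * B - \<tau> * P"
      unfolding N_def \<sigma>_def \<tau>_def assms(1,2) by algebra
    moreover have "N * (x * w' - y * u') = N * B' - N * (h * w - k * u)"
      unfolding assms(4) by (simp add: algebra_simps)
    ultimately have "N * (x * w' - y * u') = 0" using NB Q by algebra
    then show ?thesis using N0 by simp
  qed
  have "N^2 * u' = - (3/4) * \<tau> * B * x" "N^2 * w' = - (3/4) * \<tau> * B * y"
  proof -
    have "N * u' = x * (x * u' + y * w')" "N * w' = y * (x * u' + y * w')"
      unfolding N_def using tan by algebra+
    then show "N^2 * u' = - (3/4) * \<tau> * B * x" "N^2 * w' = - (3/4) * \<tau> * B * y"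
      using rad by algebra+
  qed
  then show "u' = - (3/4 * (x * k - y * h) * B / (x^2 + y^2)^2 * x)"
    "w' = - (3/4 * (x * k - y * h) * B / (x^2 + y^2)^2 * y)"
    unfolding N_def[symmetric] \<tau>_def[symmetric] using N0 by (simp_all add: field_simps)
qed

lemma has_derivative_zero_on_open:
  assumes "(f has_derivative f') (at p)" "open U" "p \<in> U" "\<And>q. q \<in> U \<Longrightarrow> f q = 0"
  shows "f' v = 0"
proof -
  have "((\<lambda>_. 0) has_derivative f') (at p)"
    using has_derivative_transform_within_open[OF assms(1-3), of "\<lambda>_. 0"] assms(4) by simp
  then show ?thesis
    using has_derivative_unique[OF has_derivative_const] by (metis (full_types))
qed

theorem proposition6:
  fixes U :: "(real^2) set" and E :: "real^2 \<Rightarrow> real^2" and E1 E2 :: "real^2 \<Rightarrow> real"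
  assumes "open U" and "U \<subseteq> UNIV - {0}"
    and "smooth_on U E"
    and "\<And>p. p \<in> U \<Longrightarrow> E p = E1 p *\<^sub>R frame1 p + E2 p *\<^sub>R frame2 p"
    and "\<And>p. p \<in> U \<Longrightarrow> is_eigenvector (sigma_matrix p) (vector [E1 p, E2 p])"
    and "\<And>p. p \<in> U \<Longrightarrow> norm (vector [E1 p, E2 p] :: real^2) = 1"
  shows "\<forall>p\<in>U. \<forall>v. levi_civita sigma_metric E p v = 0"
proof (intro ballI allI)
  fix p v assume p: "p \<in> U"
  then have p0: "p \<noteq> 0" using assms(2) by auto
  define P where "P q = 2 * (q$1 * E q $ 1 + q$2 * E q $ 2)" for q
  define B where "B q = q$1 * E q $ 2 - q$2 * E q $ 1" for q
  have rel: "\<exists>c. c \<noteq> 0 \<and> (P q)^2 + (B q)^2 = (q$1)^2 + (q$2)^2 \<and>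
      (P q)^2 - (B q)^2 = c * q$1 \<and> 2 * P q * B q = - c * q$2" if "q \<in> U" for q
    using assms(2) that
    by (intro sigma_eigenvector_relations[OF assms(5,6,4)]) (auto simp: P_def B_def)
  define E' where "E' = frechet_derivative E (at p)"
  have "Ck_on (Suc 0) U E" using assms(3) unfolding smooth_on_def by blast
  then have "(E has_derivative E') (at p)"
    using p by (simp add: E'_def frechet_derivative_works[symmetric])
  then have dE: "((\<lambda>q. E q $ i) has_derivative (\<lambda>h. E' h $ i)) (at p)" for i
    by (rule bounded_linear.has_derivative[OF bounded_linear_vec_nth])
  define P' where
    "P' h = 2 * (h$1 * E p $ 1 + h$2 * E p $ 2 + p$1 * E' h $ 1 + p$2 * E' h $ 2)" for h
  define B' where "B' h = h$1 * E p $ 2 - h$2 * E p $ 1 + p$1 * E' h $ 2 - p$2 * E' h $ 1" for h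
  have dP: "(P has_derivative P') (at p)"
    unfolding P_def P'_def
    by (auto intro!: derivative_eq_intros dE has_derivative_vec_nth simp: algebra_simps)
  have dB: "(B has_derivative B') (at p)"
    unfolding B_def B'_def
    by (auto intro!: derivative_eq_intros dE has_derivative_vec_nth simp: algebra_simps)
  have "((\<lambda>q. (P q)^2 + (B q)^2 - ((q$1)^2 + (q$2)^2)) has_derivative
      (\<lambda>h. 2 * (P p * P' h + B p * B' h - (p$1 * h$1 + p$2 * h$2)))) (at p)"
    by (auto intro!: derivative_eq_intros dP dB has_derivative_vec_nth simp: algebra_simps)
  from has_derivative_zero_on_open[OF this assms(1) p, of v]
  have eq1: "P p * P' v + B p * B' v = p$1 * v$1 + p$2 * v$2"
    using rel by force
  \<comment> \<open>Multiplying P^2 - B^2 = c x by y and 2 P B = - c y by x and adding cancels c, so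
    this function vanishes on \<open>U\<close> even if c varies irregularly with the point.\<close>
  have "((\<lambda>q. ((P q)^2 - (B q)^2) * q$2 + 2 * P q * B q * q$1) has_derivative
      (\<lambda>h. 2 * (P p * P' h - B p * B' h) * p$2 + ((P p)^2 - (B p)^2) * h$2
        + 2 * (P' h * B p + P p * B' h) * p$1 + 2 * P p * B p * h$1)) (at p)"
    by (auto intro!: derivative_eq_intros dP dB has_derivative_vec_nth
        simp: algebra_simps power2_eq_square)
  from has_derivative_zero_on_open[OF this assms(1) p, of v]
  have eq2: "2 * (P p * P' v - B p * B' v) * p$2 + ((P p)^2 - (B p)^2) * v$2
        + 2 * (P' v * B p + P p * B' v) * p$1 + 2 * P p * B p * v$1 = 0"
    using rel by fastforce
  obtain c where "c \<noteq> 0" "(P p)^2 + (B p)^2 = (p$1)^2 + (p$2)^2"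
      "(P p)^2 - (B p)^2 = c * p$1" "2 * P p * B p = - c * p$2"
    using rel[OF p] by blast
  note parallel_system[OF P_def B_def P'_def B'_def this sum_squares_vec2_nonzero[OF p0] eq1 eq2]
  then show "levi_civita sigma_metric E p v = 0"
    by (simp add: levi_civita_def christoffel_form_sigma[OF p0] E'_def[symmetric] vec_eq_iff
        forall_2 B_def)
qed

end
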